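(* For every integer $a\geq 4$, the set of (isomorphism classes of) finite, simple, connected graphs $G$ with $\mathrm{res}(G)=a$ is finite.
   Context: $d(u,v)$ is the length of a shortest $u$-$v$ path. A vertex $w$ resolves a pair $\{x,y\}$ if $d(w,x)\neq d(w,y)$. A set $S\subseteq V(G)$ is a resolving set if every pair of vertices is resolved by some vertex of $S$. The resolving number $\mathrm{res}(G)$ is the minimum $k$ such that every $k$-subset of $V(G)$ is a resolving set. *)

theory Defs
  imports "Graph_Theory.Graph_Theory"
begin

text \<open>
  A finite simple graph is a \<^locale>\<open>pair_graph\<close>: the undirected edge \<open>{u, v}\<close> is
  represented by the two arcs \<open>(u, v)\<close> and \<open>(v, u)\<close>. All notions below are meant for
  connected graphs, where a path between any two vertices exists.
\<close>

definition distance :: "'v pair_pre_digraph \<Rightarrow> 'v \<Rightarrow> 'v \<Rightarrow> nat" where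
  "distance G u v = (LEAST n. \<exists>p. pre_digraph.apath (with_proj G) u p v \<and> length p = n)"

definition resolves :: "'v pair_pre_digraph \<Rightarrow> 'v \<Rightarrow> 'v \<Rightarrow> 'v \<Rightarrow> bool" where
  "resolves G w x y \<longleftrightarrow> distance G w x \<noteq> distance G w y"

definition resolving_set :: "'v pair_pre_digraph \<Rightarrow> 'v set \<Rightarrow> bool" where
  "resolving_set G S \<longleftrightarrow> S \<subseteq> pverts G \<and>
     (\<forall>x\<in>pverts G. \<forall>y\<in>pverts G. x \<noteq> y \<longrightarrow> (\<exists>w\<in>S. resolves G w x y))"

text \<open>
  The condition holds vacuously for \<open>k > card (pverts G)\<close>; this does not affect the
  minimum, since it already holds for \<open>k = card (pverts G)\<close>, see
  \<open>resolving_number_le_card\<close> below.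
\<close>

definition resolving_number :: "'v pair_pre_digraph \<Rightarrow> nat" where
  "resolving_number G =
     (LEAST k. \<forall>S. S \<subseteq> pverts G \<and> card S = k \<longrightarrow> resolving_set G S)"

definition graph_iso_rel :: "'v pair_pre_digraph rel" where
  "graph_iso_rel = {(G, H). digraph_iso (with_proj G) (with_proj H)}"

lemma distance_self:
  assumes "pair_graph G" "u \<in> pverts G"
  shows "distance G u u = 0"
proof -
  interpret pair_graph G by fact
  have "pre_digraph.apath (with_proj G) u [] u"
    using assms(2) by (simp add: apath_Nil_iff)
  then show ?thesis
    unfolding distance_def by (intro Least_eq_0 exI[of _ "[]"]) simp
qed

lemma distance_eq_0_imp_eq:
  assumes "pair_graph G" "connected (with_proj G)" "u \<in> pverts G" "v \<in> pverts G"
    and "distance G u v = 0"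
  shows "u = v"
proof -
  interpret pair_graph G by fact
  have "strongly_connected (with_proj G)"
    using assms(2) sym_arcs by (rule symmetric_connected_imp_strongly_connected[rotated])
  then have "u \<rightarrow>\<^sup>*\<^bsub>with_proj G\<^esub> v"
    using assms(3,4) by (auto simp: strongly_connected_def)
  then obtain p where "apath u p v"
    using reachable_apath by blast
  then have "\<exists>n p. pre_digraph.apath (with_proj G) u p v \<and> length p = n"
    by blast
  from LeastI_ex[OF this] assms(5)
  have "\<exists>p. pre_digraph.apath (with_proj G) u p v \<and> length p = 0"
    by (simp add: distance_def)
  then show "u = v"
    by (auto simp: apath_Nil_iff)
qed

lemma resolving_number_le_card:
  assumes "pair_graph G" "connected (with_proj G)"
  shows "resolving_number G \<le> card (pverts G)"
proof -
  interpret pair_graph G by fact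
  have "resolving_set G (pverts G)"
    unfolding resolving_set_def resolves_def
    using distance_self[OF assms(1)] distance_eq_0_imp_eq[OF assms] by (metis order_refl)
  then show ?thesis
    unfolding resolving_number_def
    by (intro Least_le) (auto dest: card_subset_eq[OF pair_finite_verts])
qed

lemma equiv_graph_iso_rel:
  "equiv {G. pair_graph G} (graph_iso_rel \<inter> {G. pair_graph G} \<times> {G. pair_graph G})"
proof (rule equivI)
  show "refl_on {G. pair_graph G} (graph_iso_rel \<inter> {G. pair_graph G} \<times> {G. pair_graph G})"
  proof (rule refl_onI)
    fix G :: "'v pair_pre_digraph"
    assume "G \<in> {G. pair_graph G}"
    then interpret pair_graph G by simp
    have "digraph_iso (with_proj G) (with_proj G)"
      unfolding digraph_iso_def pre_digraph.digraph_isomorphism_def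
      by (intro exI[of _ "\<lparr>iso_verts = id, iso_arcs = id, iso_head = snd, iso_tail = fst\<rparr>"])
        (auto simp: app_iso_def with_proj_def wf_digraph[unfolded with_proj_def])
    then show "(G, G) \<in> graph_iso_rel \<inter> {G. pair_graph G} \<times> {G. pair_graph G}"
      by (simp add: graph_iso_rel_def pair_graph_axioms)
  qed
next
  have "digraph_iso (with_proj H) (with_proj G)" if "digraph_iso (with_proj G) (with_proj H)"
    for G H :: "'v pair_pre_digraph"
  proof (rule digraph_iso_swap[OF _ that])
    show "wf_digraph (with_proj G)"
      using that by (auto simp: digraph_iso_def pre_digraph.digraph_isomorphism_def)
  qed
  then show "sym (graph_iso_rel \<inter> {G. pair_graph G} \<times> {G. pair_graph G})"
    by (auto simp: graph_iso_rel_def sym_def)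
next
  show "trans (graph_iso_rel \<inter> {G. pair_graph G} \<times> {G. pair_graph G})"
    by (auto simp: graph_iso_rel_def trans_def intro: digraph_iso_trans)
qed auto

end

theory Submission
  imports Defs
begin

text \<open>
  Let \<open>G\<close> be connected with \<open>res(G) = a \<ge> 4\<close>, so that every pair of vertices is left unresolved
  by fewer than \<open>a\<close> vertices, while some pair \<open>x, y\<close> is left unresolved by three vertices.

  If some vertex \<open>v\<close> has three neighbours, then for every \<open>w\<close> the distances from \<open>w\<close> to \<open>v\<close> and
  these neighbours are four numbers in a set of three consecutive integers, so \<open>w\<close> fails to
  resolve one of the six pairs among them. Hence \<open>G\<close> has at most \<open>6a\<close> vertices.

  If all degrees are at most two, two of the three vertices not resolving \<open>x, y\<close>, say \<open>w\<close> and
  \<open>w'\<close>, leave \<open>x\<close> in the same direction, so \<open>w\<close> lies on a geodesic from \<open>x\<close> to \<open>w'\<close>. The geodesic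
  from \<open>w\<close> to \<open>y\<close> cannot start towards \<open>w'\<close>, so it starts towards \<open>x\<close>; the next vertex in that
  direction again does not resolve \<open>x, y\<close>, and descending one reaches \<open>x\<close> itself, which is absurd.
\<close>

section \<open>Distance in a connected graph as a metric\<close>

locale connected_pair_graph = pair_graph G for G :: "'v pair_pre_digraph" +
  assumes connected_graph: "connected (with_proj G)"
begin

abbreviation dst :: "'v \<Rightarrow> 'v \<Rightarrow> nat" where
  "dst \<equiv> distance G"

text \<open>Cutting cycles out of a walk leaves a path that is no longer. Hence
  \<open>distance\<close>, defined by paths, can be bounded by arbitrary walks, which concatenate
  and reverse freely.\<close>

lemma distance_le_length_awalk:
  assumes "awalk u p v"
  shows "dst u v \<le> length p"
proof -
  have "length (awalk_to_apath p) \<le> length p"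
    using assms
  proof (induct rule: awalk_to_apath_induct)
    case (path p)
    then have "awalk_to_apath p = p"
      by (auto simp: awalk_to_apath.simps)
    then show ?case by simp
  next
    case (decomp p q r s)
    then have "p = q @ r @ s"
      by (auto elim: awalk_cyc_decompE)
    with decomp show ?case using step_awalk_to_apath[of u p v q r s] by simp
  qed
  moreover have "dst u v \<le> length (awalk_to_apath p)"
    unfolding distance_def using apath_awalk_to_apath[OF assms] by (intro Least_le) blast
  ultimately show ?thesis by simp
qed

lemma shortest_awalk:
  assumes "u \<in> pverts G" "v \<in> pverts G"
  obtains p where "awalk u p v" "length p = dst u v"
proof -
  have "strongly_connected (with_proj G)"
    using connected_graph sym_arcs by (rule symmetric_connected_imp_strongly_connected[rotated])
  then have "u \<rightarrow>\<^sup>*\<^bsub>with_proj G\<^esub> v"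
    using assms by (auto simp: strongly_connected_def)
  then have "\<exists>n p. apath u p v \<and> length p = n"
    using reachable_apath by blast
  from LeastI_ex[OF this] have "\<exists>p. apath u p v \<and> length p = dst u v"
    by (simp add: distance_def)
  then show ?thesis
    using that awalkI_apath by blast
qed

lemma distance_zero_iff:
  assumes "u \<in> pverts G" "v \<in> pverts G"
  shows "dst u v = 0 \<longleftrightarrow> u = v"
  using assms distance_self[OF pair_graph_axioms]
    distance_eq_0_imp_eq[OF pair_graph_axioms connected_graph] by metis

lemma distance_triangle:
  assumes "u \<in> pverts G" "v \<in> pverts G" "w \<in> pverts G"
  shows "dst u w \<le> dst u v + dst v w"
proof -
  obtain p q where "awalk u p v" "length p = dst u v" "awalk v q w" "length q = dst v w"
    using assms shortest_awalk by metis
  then show ?thesis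
    using distance_le_length_awalk[OF awalk_appendI, of u p v q w] by simp
qed

lemma arc_sym: "(u, v) \<in> parcs G \<Longrightarrow> (v, u) \<in> parcs G"
  using pair_sym_arcs by (auto simp: symmetric_def dest: symD)

lemma distance_arc: "(u, v) \<in> parcs G \<Longrightarrow> dst u v = 1"
proof -
  assume arc: "(u, v) \<in> parcs G"
  then have "awalk u [(u, v)] v"
    using in_arcsD2 by (auto simp: awalk_simps)
  from distance_le_length_awalk[OF this] have "dst u v \<le> 1" by simp
  moreover have "dst u v \<noteq> 0"
    using distance_zero_iff[OF in_arcsD1[OF arc] in_arcsD2[OF arc]] pair_no_loops[OF arc] by simp
  ultimately show ?thesis by simp
qed

lemma awalk_rev:
  assumes "awalk u p v"
  shows "awalk v (rev (map prod.swap p)) u"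
  using assms
proof (induction p arbitrary: u)
  case Nil
  then show ?case by (auto simp: awalk_Nil_iff)
next
  case (Cons e p)
  obtain a b where e: "e = (a, b)" by (cases e)
  from Cons.prems have *: "(a, b) \<in> parcs G" "u = a" "awalk b p v"
    by (auto simp: awalk_Cons_iff e)
  then have "awalk b [(b, a)] a"
    using arc_sym in_arcsD1 by (auto simp: awalk_simps)
  with Cons.IH[OF *(3)] have "awalk v (rev (map prod.swap p) @ [(b, a)]) a"
    by (rule awalk_appendI)
  then show ?case by (simp add: e *)
qed

lemma distance_commute:
  assumes "u \<in> pverts G" "v \<in> pverts G"
  shows "dst u v = dst v u"
proof -
  have "dst y x \<le> dst x y" if xy: "x \<in> pverts G" "y \<in> pverts G" for x y
  proof -
    obtain p where "awalk x p y" "length p = dst x y"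
      using shortest_awalk xy by metis
    then show ?thesis
      using distance_le_length_awalk[OF awalk_rev, of x p y] by simp
  qed
  then show ?thesis
    using assms by (simp add: order_antisym)
qed

text \<open>Take for \<open>t\<close> the second vertex of a shortest walk: its tail bounds
  \<open>dst t v\<close> from above, the triangle inequality from below.\<close>

lemma step_towards:
  assumes "u \<in> pverts G" "v \<in> pverts G" "u \<noteq> v"
  obtains t where "(u, t) \<in> parcs G" "t \<in> pverts G" "dst u v = Suc (dst t v)"
proof -
  obtain p where p: "awalk u p v" "length p = dst u v"
    using shortest_awalk assms by metis
  then obtain e q where "p = e # q"
    using distance_zero_iff assms by (cases p) auto
  moreover obtain a t where "e = (a, t)" by (cases e)
  ultimately have t: "(u, t) \<in> parcs G" "awalk t q v" "dst u v = Suc (length q)"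
    using p by (auto simp: awalk_Cons_iff)
  then have tV: "t \<in> pverts G" using in_arcsD2 by blast
  have "dst u v \<le> dst u t + dst t v"
    using distance_triangle assms tV by blast
  then have "dst u v = Suc (dst t v)"
    using distance_le_length_awalk[OF t(2)] t(3) distance_arc[OF t(1)] by linarith
  then show ?thesis using that t(1) tV by blast
qed

section \<open>Unresolved pairs and the resolving number\<close>

text \<open>These are the vertices that fail to resolve \<open>x\<close> and
  \<open>y\<close>.\<close>

definition equidistant :: "'v \<Rightarrow> 'v \<Rightarrow> 'v set" where
  "equidistant x y = {w \<in> pverts G. dst w x = dst w y}"

lemma finite_equidistant: "finite (equidistant x y)"
  unfolding equidistant_def using pair_finite_verts by simp

text \<open>Otherwise some set of exactly \<open>resolving_number G\<close> vertices would lie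
  inside \<open>equidistant x y\<close> and leave this pair unresolved.\<close>

lemma card_equidistant_less_resolving_number:
  assumes "x \<in> pverts G" "y \<in> pverts G" "x \<noteq> y"
  shows "card (equidistant x y) < resolving_number G"
proof (rule ccontr)
  let ?P = "\<lambda>k. \<forall>S. S \<subseteq> pverts G \<and> card S = k \<longrightarrow> resolving_set G S"
  \<comment> \<open>No vertex set is this large, so the condition is vacuous; this ensures that the
    \<open>LEAST\<close> is attained.\<close>
  have "?P (Suc (card (pverts G)))"
    using card_mono[OF pair_finite_verts] by (metis Suc_n_not_le_n)
  then have res: "?P (resolving_number G)"
    unfolding resolving_number_def by (rule LeastI)
  assume "\<not> ?thesis"
  then obtain S where S: "S \<subseteq> equidistant x y" "card S = resolving_number G"
    using obtain_subset_with_card_n by (metis not_less)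
  then have "S \<subseteq> pverts G" by (auto simp: equidistant_def)
  with res S have "resolving_set G S" by blast
  then show False
    using assms S(1) unfolding resolving_set_def resolves_def equidistant_def by blast
qed

text \<open>By minimality some set of three vertices is not resolving, and it lies in
  \<open>equidistant x y\<close> for a pair that it leaves unresolved.\<close>

lemma card_equidistant_ge_3:
  assumes "resolving_number G \<ge> 4"
  obtains x y where "x \<in> pverts G" "y \<in> pverts G" "x \<noteq> y" "card (equidistant x y) \<ge> 3"
proof -
  have "\<not> (\<forall>S. S \<subseteq> pverts G \<and> card S = 3 \<longrightarrow> resolving_set G S)"
  proof
    assume "\<forall>S. S \<subseteq> pverts G \<and> card S = 3 \<longrightarrow> resolving_set G S"
    then have "resolving_number G \<le> 3"
      unfolding resolving_number_def by (rule Least_le)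
    with assms show False by simp
  qed
  then obtain S x y where *: "S \<subseteq> pverts G" "card S = 3" "x \<in> pverts G" "y \<in> pverts G" "x \<noteq> y"
      "\<forall>w\<in>S. \<not> resolves G w x y"
    unfolding resolving_set_def by blast
  then have "S \<subseteq> equidistant x y"
    unfolding equidistant_def resolves_def by blast
  then have "card (equidistant x y) \<ge> 3"
    using card_mono[OF finite_equidistant] *(2) by metis
  with * that show ?thesis by blast
qed

section \<open>The case of a vertex with three neighbours\<close>

lemma card_verts_le_if_three_neighbours:
  assumes arcs: "(v, x) \<in> parcs G" "(v, y) \<in> parcs G" "(v, z) \<in> parcs G"
    and neq: "x \<noteq> y" "x \<noteq> z" "y \<noteq> z"
  shows "card (pverts G) \<le> 6 * resolving_number G"
proof -
  let ?r = "resolving_number G"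
  have V: "v \<in> pverts G" "x \<in> pverts G" "y \<in> pverts G" "z \<in> pverts G"
    using arcs in_arcsD1 in_arcsD2 by blast+
  have neq_v: "v \<noteq> x" "v \<noteq> y" "v \<noteq> z"
    using arcs pair_no_loops by fastforce+
  let ?E = equidistant
  have "pverts G \<subseteq> ?E v x \<union> (?E v y \<union> (?E v z \<union> (?E x y \<union> (?E x z \<union> ?E y z))))"
  proof
    fix w assume w: "w \<in> pverts G"
    have lip: "dst w s \<le> dst w v + 1 \<and> dst w v \<le> dst w s + 1" if "(v, s) \<in> parcs G" for s
      using distance_triangle[of w v s] distance_triangle[of w s v] distance_arc[OF that]
        distance_arc[OF arc_sym[OF that]] w V(1) in_arcsD2[OF that] by simp
    have "dst w v = dst w x \<or> dst w v = dst w y \<or> dst w v = dst w z \<or>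
        dst w x = dst w y \<or> dst w x = dst w z \<or> dst w y = dst w z"
      using lip[OF arcs(1)] lip[OF arcs(2)] lip[OF arcs(3)] by linarith
    with w show "w \<in> ?E v x \<union> (?E v y \<union> (?E v z \<union> (?E x y \<union> (?E x z \<union> ?E y z))))"
      unfolding equidistant_def by blast
  qed
  then have "card (pverts G) \<le> card (?E v x \<union> (?E v y \<union> (?E v z \<union> (?E x y \<union> (?E x z \<union> ?E y z)))))"
    by (intro card_mono) (simp_all add: finite_equidistant)
  also have "\<dots> \<le> card (?E v x) + (card (?E v y) + (card (?E v z) + (card (?E x y) +
      (card (?E x z) + card (?E y z)))))"
    by (intro order_trans[OF card_Un_le] add_left_mono order_refl)
  also have "\<dots> \<le> 6 * ?r"
    using card_equidistant_less_resolving_number[OF V(1,2) neq_v(1)]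
      card_equidistant_less_resolving_number[OF V(1,3) neq_v(2)]
      card_equidistant_less_resolving_number[OF V(1,4) neq_v(3)]
      card_equidistant_less_resolving_number[OF V(2,3) neq(1)]
      card_equidistant_less_resolving_number[OF V(2,4) neq(2)]
      card_equidistant_less_resolving_number[OF V(3,4) neq(3)] by linarith
  finally show ?thesis .
qed

end

section \<open>The case of maximum degree two\<close>

locale max_degree_2_graph = connected_pair_graph +
  assumes two_neighbours:
    "\<lbrakk>(v, x) \<in> parcs G; (v, y) \<in> parcs G; (v, z) \<in> parcs G\<rbrakk> \<Longrightarrow> x = y \<or> x = z \<or> y = z"
begin

text \<open>With at most two neighbours per vertex, a geodesic that has left \<open>x\<close>
  through \<open>u\<close> has no choice in how to continue, so the longer one runs through
  \<open>w\<close>. The induction moves the arc from \<open>x\<close> to \<open>u\<close> one step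
  forward.\<close>

lemma same_direction_imp_geodesic:
  assumes "(x, u) \<in> parcs G" "w \<in> pverts G" "w' \<in> pverts G"
    and "dst x w = Suc (dst u w)" "dst x w' = Suc (dst u w')" "dst x w \<le> dst x w'"
  shows "dst x w' = dst x w + dst w w'"
  using assms
proof (induction "dst u w" arbitrary: x u)
  case 0
  then have "u = w"
    using distance_zero_iff in_arcsD2 by metis
  with 0 show ?case by simp
next
  case (Suc n)
  have uV: "u \<in> pverts G" using Suc.prems(1) in_arcsD2 by blast
  have "u \<noteq> w" "u \<noteq> w'"
    using Suc distance_zero_iff[OF uV] by force+
  obtain p where p: "(u, p) \<in> parcs G" "dst u w = Suc (dst p w)"
    using step_towards[OF uV Suc.prems(2) \<open>u \<noteq> w\<close>] by metis
  obtain p' where p': "(u, p') \<in> parcs G" "dst u w' = Suc (dst p' w')"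
    using step_towards[OF uV Suc.prems(3) \<open>u \<noteq> w'\<close>] by metis
  \<comment> \<open>Stepping back to \<open>x\<close> would increase the distance to
    \<open>w\<close> and to \<open>w'\<close>, so both \<open>p\<close> and \<open>p'\<close> are
    the other neighbour of \<open>u\<close>.\<close>
  have "x \<noteq> p" "x \<noteq> p'"
    using p p' Suc.prems by auto
  then have "p = p'"
    using two_neighbours[OF arc_sym[OF Suc.prems(1)] p(1) p'(1)] by blast
  have "dst u w' = dst u w + dst w w'"
    using Suc.hyps(1)[of p u] Suc.hyps(2) Suc.prems p p' \<open>p = p'\<close> by simp
  with Suc.prems show ?case by simp
qed

lemma equidistant_not_on_geodesic:
  assumes "x \<in> pverts G" "y \<in> pverts G" "x \<noteq> y"
    and "w \<in> equidistant x y" "w' \<in> equidistant x y" "w \<noteq> w'"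
  shows "dst x w' \<noteq> dst x w + dst w w'"
  using assms
proof (induction "dst w x" arbitrary: w w')
  case 0
  \<comment> \<open>Here \<open>w = x\<close>, so equidistance would give
    \<open>x = y\<close>.\<close>
  then show ?case
    using distance_zero_iff by (metis (mono_tags, lifting) equidistant_def mem_Collect_eq)
next
  case (Suc n)
  show ?case
  proof
    assume geo: "dst x w' = dst x w + dst w w'"
    have V: "w \<in> pverts G" "w' \<in> pverts G" and eq: "dst w x = dst w y" "dst w' x = dst w' y"
      using Suc.prems by (auto simp: equidistant_def)
    note geo' = geo[unfolded distance_commute[OF Suc.prems(1) V(1)]
      distance_commute[OF Suc.prems(1) V(2)] distance_commute[OF V]]
    have "w \<noteq> x" "w \<noteq> y"
      using Suc.hyps(2) eq distance_zero_iff V Suc.prems by force+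
    obtain v where v: "(w, v) \<in> parcs G" "v \<in> pverts G" "dst w w' = Suc (dst v w')"
      using step_towards[OF V \<open>w \<noteq> w'\<close>] by metis
    obtain t where t: "(w, t) \<in> parcs G" "t \<in> pverts G" "dst w x = Suc (dst t x)"
      using step_towards[OF V(1) Suc.prems(1) \<open>w \<noteq> x\<close>] by metis
    obtain s where s: "(w, s) \<in> parcs G" "s \<in> pverts G" "dst w y = Suc (dst s y)"
      using step_towards[OF V(1) Suc.prems(2) \<open>w \<noteq> y\<close>] by metis
    have tri: "dst w' z \<le> dst v w' + dst v z" if "z \<in> pverts G" for z
      using distance_triangle[OF V(2) v(2) that] distance_commute[OF V(2) v(2)] by simp
    \<comment> \<open>Moving from \<open>w\<close> to \<open>v\<close> brings \<open>w'\<close> one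
      closer. If it also brought \<open>x\<close> or \<open>y\<close> closer, the route through
      \<open>v\<close> would be shorter than \<open>dst w w' + dst w x\<close>, the common distance
      of \<open>w'\<close> to \<open>x\<close> and \<open>y\<close>.\<close>
    have "v \<noteq> t"
      using tri[OF Suc.prems(1)] v(3) t(3) geo' distance_commute[OF V] by auto
    moreover have "v \<noteq> s"
      using tri[OF Suc.prems(2)] v(3) s(3) geo' eq distance_commute[OF V] by auto
    ultimately have "s = t"
      using two_neighbours[OF v(1) s(1) t(1)] by blast
    then have "t \<in> equidistant x y"
      using t s eq by (simp add: equidistant_def)
    moreover have "t \<noteq> w" using t by auto
    \<comment> \<open>The pair \<open>t\<close>, \<open>w\<close> now takes the place of
      \<open>w\<close>, \<open>w'\<close> in the induction hypothesis.\<close>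
    moreover have "dst x w = dst x t + dst t w"
      using t(3) distance_arc[OF arc_sym[OF t(1)]] distance_commute[OF Suc.prems(1) V(1)]
        distance_commute[OF Suc.prems(1) t(2)] by simp
    moreover have "n = dst t x" using t(3) Suc.hyps(2) by simp
    ultimately show False
      using Suc.hyps(1) Suc.prems by blast
  qed
qed

text \<open>Send each unresolving vertex to the first step \<open>f w\<close> of a geodesic from
  \<open>x\<close> to it. The two preceding lemmas make \<open>f\<close> injective, and
  \<open>x\<close> has at most two neighbours.\<close>

lemma card_equidistant_le_2:
  assumes xy: "x \<in> pverts G" "y \<in> pverts G" "x \<noteq> y"
  shows "card (equidistant x y) \<le> 2"
proof -
  have "\<exists>u. (x, u) \<in> parcs G \<and> dst x w = Suc (dst u w)" if "w \<in> equidistant x y" for w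
  proof -
    have "w \<in> pverts G" "dst w x = dst w y" using that by (auto simp: equidistant_def)
    then have "x \<noteq> w" using xy distance_zero_iff by metis
    then show ?thesis
      using step_towards[OF xy(1) \<open>w \<in> pverts G\<close>] by metis
  qed
  then obtain f where f: "\<And>w. w \<in> equidistant x y \<Longrightarrow> (x, f w) \<in> parcs G"
      "\<And>w. w \<in> equidistant x y \<Longrightarrow> dst x w = Suc (dst (f w) w)"
    by metis
  have less: "w = w'" if "w \<in> equidistant x y" "w' \<in> equidistant x y" "f w = f w'"
    "dst x w \<le> dst x w'" for w w'
    using same_direction_imp_geodesic[OF f(1)[OF that(1)], of w w'] f(2)[OF that(1)] f(2)[OF that(2)]
      equidistant_not_on_geodesic[OF xy that(1,2)] that by (auto simp: equidistant_def)
  then have inj: "inj_on f (equidistant x y)"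
    by (intro inj_onI) (metis nat_le_linear)
  show ?thesis
  proof (rule ccontr)
    assume "\<not> ?thesis"
    then have "3 \<le> card (f ` equidistant x y)"
      using card_image[OF inj] by simp
    then obtain T where "T \<subseteq> f ` equidistant x y" "card T = 3"
      using obtain_subset_with_card_n by metis
    then obtain p q r where "{p, q, r} \<subseteq> f ` equidistant x y" "p \<noteq> q" "p \<noteq> r" "q \<noteq> r"
      by (auto simp: card_3_iff)
    moreover from this have "(x, p) \<in> parcs G" "(x, q) \<in> parcs G" "(x, r) \<in> parcs G"
      using f(1) by auto
    ultimately show False using two_neighbours by metis
  qed
qed

end

lemma (in connected_pair_graph) card_verts_le_resolving_number:
  assumes "resolving_number G \<ge> 4"
  shows "card (pverts G) \<le> 6 * resolving_number G"
proof (rule ccontr)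
  assume *: "\<not> ?thesis"
  \<comment> \<open>The negated bound excludes three distinct neighbours of any vertex, which is the
    locale assumption.\<close>
  interpret max_degree_2_graph G
    by unfold_locales (use * card_verts_le_if_three_neighbours in blast)
  obtain x y where "x \<in> pverts G" "y \<in> pverts G" "x \<noteq> y" "card (equidistant x y) \<ge> 3"
    using card_equidistant_ge_3[OF assms] .
  then show False
    using card_equidistant_le_2[of x y] by simp
qed

section \<open>Finitely many isomorphism classes of bounded order\<close>

lemma digraph_iso_map:
  assumes "pair_graph G" "inj_on h (pverts G)"
  shows "digraph_iso (with_proj G)
    (with_proj \<lparr>pverts = h ` pverts G, parcs = map_prod h h ` parcs G\<rparr>)"
proof -
  interpret pair_graph G by fact
  have "parcs G \<subseteq> pverts G \<times> pverts G"
    using wellformed' by auto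
  then have "inj_on (map_prod h h) (parcs G)"
    using map_prod_inj_on[OF assms(2) assms(2)] inj_on_subset by blast
  then show ?thesis
    using assms(2) wf_digraph
    unfolding digraph_iso_def pre_digraph.digraph_isomorphism_def
    by (intro exI[of _ "\<lparr>iso_verts = h, iso_arcs = map_prod h h, iso_head = snd, iso_tail = fst\<rparr>"])
      (auto simp: app_iso_def with_proj_def)
qed

text \<open>The type \<open>'v\<close> may be infinite, so each graph is relabelled as a graph on
  natural numbers below \<open>N\<close>. Only finitely many of these exist, and graphs with the
  same relabelled copy are isomorphic.\<close>

lemma finite_iso_classes_card_le:
  fixes A :: "'v pair_pre_digraph set"
  assumes "\<And>G. G \<in> A \<Longrightarrow> pair_graph G \<and> card (pverts G) \<le> N"
  shows "finite (A // graph_iso_rel)"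
proof -
  have "\<exists>K :: nat pair_pre_digraph. digraph_iso (with_proj G) (with_proj K) \<and>
      pverts K \<subseteq> {..<N} \<and> parcs K \<subseteq> {..<N} \<times> {..<N}" if "G \<in> A" for G
  proof -
    interpret pair_graph G using assms that by blast
    obtain h where h: "bij_betw h (pverts G) {0..<card (pverts G)}"
      using ex_bij_betw_finite_nat[OF pair_finite_verts] by blast
    then have sub: "h ` pverts G \<subseteq> {..<N}"
      using assms[OF that] by (auto simp: bij_betw_def)
    then have "map_prod h h ` parcs G \<subseteq> {..<N} \<times> {..<N}"
      using wellformed' by fastforce
    with sub show ?thesis
      using digraph_iso_map[OF pair_graph_axioms bij_betw_imp_inj_on[OF h]]
      by (intro exI[of _ "\<lparr>pverts = h ` pverts G, parcs = map_prod h h ` parcs G\<rparr>"]) simp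
  qed
  then obtain c :: "'v pair_pre_digraph \<Rightarrow> nat pair_pre_digraph"
    where iso: "\<And>G. G \<in> A \<Longrightarrow> digraph_iso (with_proj G) (with_proj (c G))"
      and bnd: "\<And>G. G \<in> A \<Longrightarrow> pverts (c G) \<subseteq> {..<N} \<and> parcs (c G) \<subseteq> {..<N} \<times> {..<N}"
    by metis
  have "c ` A \<subseteq> (\<lambda>(V, E). \<lparr>pverts = V, parcs = E\<rparr>) ` (Pow {..<N} \<times> Pow ({..<N} \<times> {..<N}))"
  proof
    fix K assume "K \<in> c ` A"
    then have "(pverts K, parcs K) \<in> Pow {..<N} \<times> Pow ({..<N} \<times> {..<N})"
      using bnd by auto
    then show "K \<in> (\<lambda>(V, E). \<lparr>pverts = V, parcs = E\<rparr>) ` (Pow {..<N} \<times> Pow ({..<N} \<times> {..<N}))"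
      by (rule rev_image_eqI) simp
  qed
  then have fin: "finite (c ` A)"
    by (rule finite_subset) simp
  \<comment> \<open>The types are kept general because symmetry is used both between
    \<open>nat\<close> and \<open>'v\<close> graphs and among \<open>'v\<close> graphs.
    Well-formedness of \<open>K\<close> is part of the isomorphism.\<close>
  have swap: "digraph_iso H K" if "digraph_iso K H" for K :: "('a, 'b) pre_digraph"
      and H :: "('c, 'd) pre_digraph"
    using digraph_iso_swap[OF _ that] that
    by (auto simp: digraph_iso_def pre_digraph.digraph_isomorphism_def)
  have cls: "graph_iso_rel `` {G} = graph_iso_rel `` {H}" if "G \<in> A" "H \<in> A" "c G = c H" for G H
  proof -
    have GH: "digraph_iso (with_proj G) (with_proj H)"
      using digraph_iso_trans[OF iso[OF that(1)]] swap[OF iso[OF that(2)]] that(3) by simp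
    then show ?thesis
      using swap[OF GH] by (auto simp: graph_iso_rel_def intro: digraph_iso_trans)
  qed
  \<comment> \<open>A class is recovered from the relabelled copy \<open>K\<close> of any member: by
    \<open>cls\<close> it does not matter which preimage \<open>inv_into\<close> picks.\<close>
  have "A // graph_iso_rel \<subseteq> (\<lambda>K. graph_iso_rel `` {inv_into A c K}) ` c ` A"
  proof
    fix X assume "X \<in> A // graph_iso_rel"
    then obtain G where G: "G \<in> A" "X = graph_iso_rel `` {G}"
      by (auto elim: quotientE)
    then have "X = graph_iso_rel `` {inv_into A c (c G)}"
      using cls[OF G(1) inv_into_into[of "c G" c A]] by (simp add: f_inv_into_f)
    with G(1) show "X \<in> (\<lambda>K. graph_iso_rel `` {inv_into A c K}) ` c ` A"
      by blast
  qed
  then show ?thesis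
    using fin by (rule finite_subset[OF _ finite_imageI])
qed

theorem theorem3p7:
  fixes a :: nat
  assumes "a \<ge> 4"
  shows "finite ({G :: 'v pair_pre_digraph. pair_graph G \<and> connected (with_proj G) \<and>
                   resolving_number G = a} // graph_iso_rel)"
proof (rule finite_iso_classes_card_le[where N = "6 * a"])
  fix G :: "'v pair_pre_digraph"
  assume "G \<in> {G. pair_graph G \<and> connected (with_proj G) \<and> resolving_number G = a}"
  then have G: "pair_graph G" "connected (with_proj G)" "resolving_number G = a"
    by auto
  then interpret connected_pair_graph G
    by (simp add: connected_pair_graph_def connected_pair_graph_axioms_def)
  show "pair_graph G \<and> card (pverts G) \<le> 6 * a"
    using G card_verts_le_resolving_number assms by simp
qed

end
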